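(* Let $X$ be a $1$-homogeneous metric space. Then one of the following is true: (1) $X$ is isosceles-generated; (2) $X$ is a rainbow duplicate of an isosceles-generated space; (3) $X$ is a Boolean metric space. Suppose that $X$ is even $2$-homogeneous. Then one of the following is true: (1') $X$ is isosceles-generated; (2') $X$ is isosceles-free.
   Context: Isometries are bijective; $\operatorname{Aut}(X)$ is the group of all isometries $X\to X$; $\operatorname{Dist}(X)=\{d(x,y):x,y\in X\}$. A metric space $X$ is $n$-homogeneous if every isometry $f\colon A\to B$ between subspaces $A,B\subseteq X$ with $|A|\le n$ extends to some $F\in\operatorname{Aut}(X)$. $X$ is isosceles-free if $d(x,y)\ne d(x,z)$ for all pairwise distinct $x,y,z\in X$. A group is Boolean if all its elements satisfy $g^2=1$. A Boolean metric space is a nonempty $1$-homogeneous metric space $X$ such that $\operatorname{Aut}(X)$ is a Boolean group. For a $1$-homogeneous space $X$, let $\sim$ be the equivalence relation on $X$ generated by all pairs $(x,y)$ for which there is $z\in X$, $z\neq y$, with $d(x,y)=d(x,z)$. The classes of $\sim$ are the isosceles-generated components of $X$. $X$ is isosceles-generated if there is at most one such component. Rainbow duplicate: let $Y$ be a $1$-homogeneous metric space, and let $H\le\operatorname{Aut}(Y)$ be an Abelian subgroup such that for all $x,y\in Y$ there is a unique $h\in H$, denoted $h_x^y$, with $h(x)=y$. Suppose there is $g\in\operatorname{Aut}(Y)$ with $g\circ g=\mathrm{id}$ and $g\circ h\circ g^{-1}=h^{-1}$ for every $h\in H$. Let $r\colon H\to(0,\infty)\setminus\operatorname{Dist}(Y)$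 be an injective map such that the following distance on $Y\times\{0,1\}$ satisfies the triangle inequality: $d(\langle x,0\rangle,\langle y,0\rangle)=d(\langle x,1\rangle,\langle y,1\rangle)=d_Y(x,y)$ and $d(\langle x,0\rangle,\langle y,1\rangle)=d(\langle y,1\rangle,\langle x,0\rangle)=r(h_x^y)$. The resulting metric space $Y\times_r 2$ is called a rainbow duplicate of $Y$; a metric space is said to be a rainbow duplicate of $Y$ if it is isometric to some such $Y\times_r 2$. *)

theory Defs
  imports "HOL-Analysis.Abstract_Metric_Spaces" "HOL-Algebra.Bij"
begin

definition isometry_between ::
    "'a set \<Rightarrow> ('a \<Rightarrow> 'a \<Rightarrow> real) \<Rightarrow> 'b set \<Rightarrow> ('b \<Rightarrow> 'b \<Rightarrow> real) \<Rightarrow> ('a \<Rightarrow> 'b) \<Rightarrow> bool" where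
  "isometry_between A dA B dB f \<longleftrightarrow>
     bij_betw f A B \<and> (\<forall>x\<in>A. \<forall>y\<in>A. dB (f x) (f y) = dA x y)"

definition isometric ::
    "'a set \<Rightarrow> ('a \<Rightarrow> 'a \<Rightarrow> real) \<Rightarrow> 'b set \<Rightarrow> ('b \<Rightarrow> 'b \<Rightarrow> real) \<Rightarrow> bool" where
  "isometric A dA B dB \<longleftrightarrow> (\<exists>f. isometry_between A dA B dB f)"

(* As in BijGroup, elements of the carrier are extensional on X, so that each isometry of X
   is represented by exactly one function on the ambient type. *)
definition Aut :: "'a set \<Rightarrow> ('a \<Rightarrow> 'a \<Rightarrow> real) \<Rightarrow> ('a \<Rightarrow> 'a) monoid" where
  "Aut X d = (BijGroup X)\<lparr>carrier := {f \<in> Bij X. isometry_between X d X d f}\<rparr>"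

lemma subgroup_isometries: "subgroup {f \<in> Bij X. isometry_between X d X d f} (BijGroup X)"
proof -
  interpret group "BijGroup X" by (rule group_BijGroup)
  show ?thesis
  proof (rule subgroupI)
    show "{f \<in> Bij X. isometry_between X d X d f} \<subseteq> carrier (BijGroup X)"
      by (simp add: BijGroup_def Collect_restrict)
    have "isometry_between X d X d (\<lambda>x\<in>X. x)"
      using id_Bij[of X] by (simp add: isometry_between_def Bij_def)
    with id_Bij[of X] show "{f \<in> Bij X. isometry_between X d X d f} \<noteq> {}" by blast
  next
    fix f assume "f \<in> {f \<in> Bij X. isometry_between X d X d f}"
    then have f: "f \<in> Bij X" and iso: "\<forall>x\<in>X. \<forall>y\<in>X. d (f x) (f y) = d x y"
      and bij: "bij_betw f X X"
      by (simp_all add: isometry_between_def)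
    let ?g = "\<lambda>x\<in>X. inv_into X f x"
    have g: "?g \<in> Bij X"
      using f by (rule restrict_inv_into_Bij)
    have inv: "inv\<^bsub>BijGroup X\<^esub> f = ?g"
    proof (rule inv_equality)
      show "?g \<otimes>\<^bsub>BijGroup X\<^esub> f = \<one>\<^bsub>BijGroup X\<^esub>"
        using f g Bij_compose_restrict_eq[OF f] by (simp add: BijGroup_def)
    qed (use f g in \<open>simp_all add: BijGroup_def\<close>)
    have "d (?g x) (?g y) = d x y" if x: "x \<in> X" and y: "y \<in> X" for x y
    proof -
      have im: "f ` X = X" using bij by (simp add: bij_betw_def)
      have "inv_into X f x \<in> X" "inv_into X f y \<in> X"
        "f (inv_into X f x) = x" "f (inv_into X f y) = y"
        using x y im by (simp_all add: inv_into_into f_inv_into_f)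
      then have "d (inv_into X f x) (inv_into X f y) = d x y"
        using iso by force
      then show ?thesis using x y by simp
    qed
    then have "isometry_between X d X d ?g"
      unfolding isometry_between_def using g by (simp only: Bij_def) blast
    with g show "inv\<^bsub>BijGroup X\<^esub> f \<in> {f \<in> Bij X. isometry_between X d X d f}"
      unfolding inv by blast
  next
    fix f g
    assume "f \<in> {f \<in> Bij X. isometry_between X d X d f}"
      and "g \<in> {f \<in> Bij X. isometry_between X d X d f}"
    then have f: "f \<in> Bij X" and isof: "\<forall>x\<in>X. \<forall>y\<in>X. d (f x) (f y) = d x y"
      and g: "g \<in> Bij X" and isog: "\<forall>x\<in>X. \<forall>y\<in>X. d (g x) (g y) = d x y"
      by (simp_all add: isometry_between_def)
    have fg: "compose X f g \<in> Bij X" using f g by (rule compose_Bij)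
    have "g x \<in> X" if "x \<in> X" for x
      using Bij_imp_funcset[OF g] that by (rule funcset_mem)
    then have "isometry_between X d X d (compose X f g)"
      using fg isof isog by (simp add: isometry_between_def Bij_def compose_eq)
    with fg f g show "f \<otimes>\<^bsub>BijGroup X\<^esub> g \<in> {f \<in> Bij X. isometry_between X d X d f}"
      by (simp add: BijGroup_def)
  qed
qed

lemma group_Aut: "group (Aut X d)"
  unfolding Aut_def using subgroup.subgroup_is_group[OF subgroup_isometries group_BijGroup] .

definition Dist :: "'a set \<Rightarrow> ('a \<Rightarrow> 'a \<Rightarrow> real) \<Rightarrow> real set" where
  "Dist X d = {d x y |x y. x \<in> X \<and> y \<in> X}"

definition n_homogeneous :: "nat \<Rightarrow> 'a set \<Rightarrow> ('a \<Rightarrow> 'a \<Rightarrow> real) \<Rightarrow> bool" where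
  "n_homogeneous n X d \<longleftrightarrow>
     (\<forall>A B f. A \<subseteq> X \<and> B \<subseteq> X \<and> finite A \<and> card A \<le> n \<and> isometry_between A d B d f
        \<longrightarrow> (\<exists>F\<in>carrier (Aut X d). \<forall>x\<in>A. F x = f x))"

definition isosceles_free :: "'a set \<Rightarrow> ('a \<Rightarrow> 'a \<Rightarrow> real) \<Rightarrow> bool" where
  "isosceles_free X d \<longleftrightarrow>
     (\<forall>x\<in>X. \<forall>y\<in>X. \<forall>z\<in>X. x \<noteq> y \<and> y \<noteq> z \<and> x \<noteq> z \<longrightarrow> d x y \<noteq> d x z)"

definition Boolean_group :: "('a, 'b) monoid_scheme \<Rightarrow> bool" where
  "Boolean_group G \<longleftrightarrow> group G \<and> (\<forall>g\<in>carrier G. g \<otimes>\<^bsub>G\<^esub> g = \<one>\<^bsub>G\<^esub>)"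

definition Boolean_metric_space :: "'a set \<Rightarrow> ('a \<Rightarrow> 'a \<Rightarrow> real) \<Rightarrow> bool" where
  "Boolean_metric_space X d \<longleftrightarrow>
     Metric_space X d \<and> X \<noteq> {} \<and> n_homogeneous 1 X d \<and> Boolean_group (Aut X d)"

definition isosceles_pair :: "'a set \<Rightarrow> ('a \<Rightarrow> 'a \<Rightarrow> real) \<Rightarrow> 'a \<Rightarrow> 'a \<Rightarrow> bool" where
  "isosceles_pair X d x y \<longleftrightarrow> x \<in> X \<and> y \<in> X \<and> (\<exists>z\<in>X. z \<noteq> y \<and> d x y = d x z)"

(* equivclp is reflexive on the whole ambient type, hence the restriction to X. *)
definition isosceles_rel :: "'a set \<Rightarrow> ('a \<Rightarrow> 'a \<Rightarrow> real) \<Rightarrow> ('a \<times> 'a) set" where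
  "isosceles_rel X d = {(x, y). x \<in> X \<and> y \<in> X \<and> equivclp (isosceles_pair X d) x y}"

definition isosceles_components :: "'a set \<Rightarrow> ('a \<Rightarrow> 'a \<Rightarrow> real) \<Rightarrow> 'a set set" where
  "isosceles_components X d = X // isosceles_rel X d"

definition isosceles_generated :: "'a set \<Rightarrow> ('a \<Rightarrow> 'a \<Rightarrow> real) \<Rightarrow> bool" where
  "isosceles_generated X d \<longleftrightarrow>
     (\<forall>C\<in>isosceles_components X d. \<forall>D\<in>isosceles_components X d. C = D)"

(* The element of H written h_x^y, i.e. the one moving x to y. *)
definition transl :: "('a \<Rightarrow> 'a) set \<Rightarrow> 'a \<Rightarrow> 'a \<Rightarrow> ('a \<Rightarrow> 'a)" where
  "transl H x y = (THE h. h \<in> H \<and> h x = y)"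

(* Y x {0,1} is encoded as Y \<times> UNIV with False for 0 and True for 1. Values off this
   carrier are irrelevant (and unspecified). *)
fun rainbow_dist ::
    "('a \<Rightarrow> 'a \<Rightarrow> real) \<Rightarrow> ('a \<Rightarrow> 'a) set \<Rightarrow> (('a \<Rightarrow> 'a) \<Rightarrow> real) \<Rightarrow> 'a \<times> bool \<Rightarrow> 'a \<times> bool \<Rightarrow> real" where
  "rainbow_dist dY H r (x, False) (y, False) = dY x y"
| "rainbow_dist dY H r (x, True) (y, True) = dY x y"
| "rainbow_dist dY H r (x, False) (y, True) = r (transl H x y)"
| "rainbow_dist dY H r (y, True) (x, False) = r (transl H x y)"

definition rainbow_datum ::
    "'a set \<Rightarrow> ('a \<Rightarrow> 'a \<Rightarrow> real) \<Rightarrow> ('a \<Rightarrow> 'a) set \<Rightarrow> (('a \<Rightarrow> 'a) \<Rightarrow> real) \<Rightarrow> bool" where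
  "rainbow_datum Y dY H r \<longleftrightarrow>
     Metric_space Y dY \<and> n_homogeneous 1 Y dY \<and>
     subgroup H (Aut Y dY) \<and> comm_group ((Aut Y dY)\<lparr>carrier := H\<rparr>) \<and>
     (\<forall>x\<in>Y. \<forall>y\<in>Y. \<exists>!h. h \<in> H \<and> h x = y) \<and>
     (\<exists>g\<in>carrier (Aut Y dY). g \<otimes>\<^bsub>Aut Y dY\<^esub> g = \<one>\<^bsub>Aut Y dY\<^esub> \<and>
        (\<forall>h\<in>H. g \<otimes>\<^bsub>Aut Y dY\<^esub> h \<otimes>\<^bsub>Aut Y dY\<^esub> inv\<^bsub>Aut Y dY\<^esub> g = inv\<^bsub>Aut Y dY\<^esub> h)) \<and>
     inj_on r H \<and> r ` H \<subseteq> {0<..} - Dist Y dY \<and>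
     (\<forall>p\<in>Y \<times> UNIV. \<forall>q\<in>Y \<times> UNIV. \<forall>s\<in>Y \<times> UNIV.
        rainbow_dist dY H r p s \<le> rainbow_dist dY H r p q + rainbow_dist dY H r q s)"

definition rainbow_duplicate ::
    "'a set \<Rightarrow> ('a \<Rightarrow> 'a \<Rightarrow> real) \<Rightarrow> 'b set \<Rightarrow> ('b \<Rightarrow> 'b \<Rightarrow> real) \<Rightarrow> bool" where
  "rainbow_duplicate X d Y dY \<longleftrightarrow>
     (\<exists>H r. rainbow_datum Y dY H r \<and> isometric X d (Y \<times> UNIV) (rainbow_dist dY H r))"

(* HOL cannot quantify existentially over types, so the space Y is taken on the ambient type
   of X. This loses no generality: if X is a rainbow duplicate of Y, then Y is isometric to a
   subspace of X (the image of Y x {0}), and being a base space is isometry invariant. *)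
definition rainbow_duplicate_of_isosceles_generated ::
    "'a set \<Rightarrow> ('a \<Rightarrow> 'a \<Rightarrow> real) \<Rightarrow> bool" where
  "rainbow_duplicate_of_isosceles_generated X d \<longleftrightarrow>
     (\<exists>(Y :: 'a set) dY. isosceles_generated Y dY \<and> rainbow_duplicate X d Y dY)"

end

theory Submission
  imports Defs
begin

text \<open>
  If \<open>x\<close> and \<open>y\<close> lie in different isosceles-generated components, then \<open>y\<close> is the only point at
  its distance from \<open>x\<close>. Suppose that there are at least two components. An isometry fixing \<open>x\<close>
  then fixes every point outside the component of \<open>x\<close>, hence, applying this again to a point
  outside, everything: \<open>Aut(X)\<close> acts freely (\<open>fixed_point_free\<close>). This already excludes isosceles
  triples in a \<open>2\<close>-homogeneous space, because an isometry fixing the apex and moving one end of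
  the base to the other would be the identity.

  For the first trichotomy, let \<open>f\<close> move \<open>x\<close> out of its component. Since \<open>f x\<close> and \<open>f (f x)\<close> are as
  far apart as \<open>x\<close> and \<open>f x\<close>, uniqueness gives \<open>f (f x) = x\<close>, and freeness makes \<open>f\<close> an involution.
  So in \<open>Aut(X)\<close> every element outside the stabilizer \<open>H\<close> of a component is an involution. Each
  such element inverts \<open>H\<close> by conjugation, so \<open>H\<close> is Abelian. With three or more components some
  product of two elements outside \<open>H\<close> is again outside \<open>H\<close>; it both inverts and centralizes \<open>H\<close>, so
  \<open>Aut(X)\<close> is Boolean.

  With exactly two components, fix \<open>a\<close> in one of them, \<open>C\<close>, and \<open>w\<close> in the other. The group \<open>H\<close> acts
  regularly on both, and \<open>h a \<mapsto> h w\<close> is an isometry between them commuting with \<open>H\<close>: the involution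
  exchanging \<open>a\<close> and \<open>w\<close> turns \<open>h w\<close> into \<open>inv h a\<close>, and \<open>h a \<mapsto> inv h a\<close> is an isometry
  since \<open>H\<close> is Abelian. The last map is also the reflection required of the base of a rainbow
  duplicate, and \<open>r h = d a (h w)\<close> is injective by the uniqueness of points at a given distance.
\<close>

section \<open>Isometry groups acting on points\<close>

lemma mem_Aut_iff:
  "f \<in> carrier (Aut X d) \<longleftrightarrow>
     f \<in> extensional X \<and> bij_betw f X X \<and> (\<forall>x\<in>X. \<forall>y\<in>X. d (f x) (f y) = d x y)"
  by (auto simp: Aut_def Bij_def isometry_between_def)

lemma Aut_closed: "f \<in> carrier (Aut X d) \<Longrightarrow> x \<in> X \<Longrightarrow> f x \<in> X"
  using bij_betw_apply[of f X X x] by (simp add: mem_Aut_iff)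

lemma Aut_dist: "f \<in> carrier (Aut X d) \<Longrightarrow> x \<in> X \<Longrightarrow> y \<in> X \<Longrightarrow> d (f x) (f y) = d x y"
  by (simp add: mem_Aut_iff)

lemma Aut_mult:
  assumes "f \<in> carrier (Aut X d)" "g \<in> carrier (Aut X d)"
  shows "f \<otimes>\<^bsub>Aut X d\<^esub> g = compose X f g"
  using assms by (simp add: Aut_def BijGroup_def)

lemma Aut_mult_apply:
  assumes "f \<in> carrier (Aut X d)" "g \<in> carrier (Aut X d)" "x \<in> X"
  shows "(f \<otimes>\<^bsub>Aut X d\<^esub> g) x = f (g x)"
  using assms by (simp add: Aut_mult compose_eq)

lemma Aut_one: "\<one>\<^bsub>Aut X d\<^esub> = (\<lambda>x\<in>X. x)"
  by (simp add: Aut_def BijGroup_def)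

lemma Aut_one_apply: "x \<in> X \<Longrightarrow> \<one>\<^bsub>Aut X d\<^esub> x = x"
  by (simp add: Aut_one)

lemma Aut_inv_left:
  assumes "f \<in> carrier (Aut X d)" "x \<in> X"
  shows "(inv\<^bsub>Aut X d\<^esub> f) (f x) = x"
proof -
  interpret group "Aut X d" by (rule group_Aut)
  show ?thesis
    using assms Aut_mult_apply[of "inv\<^bsub>Aut X d\<^esub> f" X d f x] by (simp add: Aut_one_apply)
qed

lemma Aut_inv_right:
  assumes "f \<in> carrier (Aut X d)" "x \<in> X"
  shows "f ((inv\<^bsub>Aut X d\<^esub> f) x) = x"
proof -
  interpret group "Aut X d" by (rule group_Aut)
  show ?thesis
    using assms Aut_mult_apply[of f X d "inv\<^bsub>Aut X d\<^esub> f" x] by (simp add: Aut_one_apply)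
qed

lemma Aut_eqI:
  assumes "f \<in> carrier (Aut X d)" "g \<in> carrier (Aut X d)" "\<And>x. x \<in> X \<Longrightarrow> f x = g x"
  shows "f = g"
  using assms by (auto simp: mem_Aut_iff intro: extensionalityI)

text \<open>Any map between singletons is an isometry, so extending it means moving one point to another.\<close>

lemma one_homogeneous_iff_transitive:
  assumes "Metric_space X d"
  shows "n_homogeneous 1 X d \<longleftrightarrow> (\<forall>x\<in>X. \<forall>y\<in>X. \<exists>F\<in>carrier (Aut X d). F x = y)"
proof
  interpret Metric_space X d by fact
  assume hom: "n_homogeneous 1 X d"
  show "\<forall>x\<in>X. \<forall>y\<in>X. \<exists>F\<in>carrier (Aut X d). F x = y"
  proof (intro ballI)
    fix x y assume "x \<in> X" "y \<in> X"
    then have "isometry_between {x} d {y} d (\<lambda>_. y)"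
      by (simp add: isometry_between_def bij_betw_def)
    with hom[unfolded n_homogeneous_def, rule_format, of "{x}" "{y}" "\<lambda>_. y"] \<open>x \<in> X\<close> \<open>y \<in> X\<close>
    show "\<exists>F\<in>carrier (Aut X d). F x = y" by auto
  qed
next
  assume trans: "\<forall>x\<in>X. \<forall>y\<in>X. \<exists>F\<in>carrier (Aut X d). F x = y"
  interpret group "Aut X d" by (rule group_Aut)
  show "n_homogeneous 1 X d"
    unfolding n_homogeneous_def
  proof (intro allI impI)
    fix A B f assume *: "A \<subseteq> X \<and> B \<subseteq> X \<and> finite A \<and> card A \<le> 1 \<and> isometry_between A d B d f"
    then consider "A = {}" | x where "A = {x}"
      by (metis One_nat_def card_0_eq card_1_singletonE le_Suc_eq le_zero_eq)
    then show "\<exists>F\<in>carrier (Aut X d). \<forall>x\<in>A. F x = f x"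
    proof cases
      case 1 then show ?thesis by (auto intro: one_closed)
    next
      case 2
      with * have "x \<in> X" "f x \<in> X" by (auto simp: isometry_between_def bij_betw_def)
      with trans 2 show ?thesis by auto
    qed
  qed
qed

section \<open>Groups that are involutive outside a subgroup\<close>

context group
begin

text \<open>Both \<open>g\<close> and \<open>h \<otimes> g\<close> lie outside \<open>H\<close>, so both are their own inverses.\<close>

lemma involution_outside_inverts:
  assumes H: "subgroup H G" and inv2: "\<forall>g\<in>carrier G - H. g \<otimes> g = \<one>"
    and g: "g \<in> carrier G" "g \<notin> H" and h: "h \<in> H"
  shows "h \<otimes> g = g \<otimes> inv h"
proof -
  interpret subgroup H G by fact
  have hG: "h \<in> carrier G" using h by (rule mem_carrier)
  have "h \<otimes> g \<notin> H"
  proof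
    assume hg: "h \<otimes> g \<in> H"
    have "inv h \<otimes> (h \<otimes> g) \<in> H" using m_closed[OF m_inv_closed[OF h] hg] .
    with g hG show False by (simp add: m_assoc[symmetric])
  qed
  then have "(h \<otimes> g) \<otimes> (h \<otimes> g) = \<one>" using inv2 g hG by blast
  then have "inv (h \<otimes> g) = h \<otimes> g" using g hG by (intro inv_equality) auto
  moreover have "inv g = g" using inv2 g by (intro inv_equality) auto
  ultimately show ?thesis using g hG by (simp add: inv_mult_group)
qed

text \<open>Conjugation by \<open>g\<close> is an automorphism, and inversion is one only on an Abelian group.\<close>

lemma commute_of_involution_outside:
  assumes H: "subgroup H G" and inv2: "\<forall>g\<in>carrier G - H. g \<otimes> g = \<one>"
    and proper: "g \<in> carrier G" "g \<notin> H" and h: "h \<in> H" and k: "k \<in> H"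
  shows "h \<otimes> k = k \<otimes> h"
proof -
  interpret subgroup H G by fact
  note swap = involution_outside_inverts[OF H inv2 proper]
  have G: "h \<in> carrier G" "k \<in> carrier G" using h k by (auto intro: mem_carrier)
  have "g \<otimes> inv (h \<otimes> k) = (h \<otimes> k) \<otimes> g" using swap h k by simp
  also have "\<dots> = h \<otimes> (g \<otimes> inv k)" using swap[OF k] G proper by (simp add: m_assoc)
  also have "\<dots> = g \<otimes> (inv h \<otimes> inv k)"
    using swap[OF h] G proper by (simp add: m_assoc[symmetric])
  finally have "inv (h \<otimes> k) = inv h \<otimes> inv k" using G proper by simp
  then have "inv (h \<otimes> k) = inv (k \<otimes> h)" using G by (simp add: inv_mult_group)
  then have "inv (inv (h \<otimes> k)) = inv (inv (k \<otimes> h))" by (rule arg_cong)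
  then show ?thesis using G by simp
qed

text \<open>
  The hypothesis on \<open>g \<otimes> k\<close> says that \<open>H\<close> has index at least three. All of \<open>g\<close>, \<open>k\<close> and \<open>g \<otimes> k\<close> invert
  \<open>H\<close>, but inverting twice is the identity.
\<close>

lemma Boolean_of_involution_outside:
  assumes H: "subgroup H G" and inv2: "\<forall>g\<in>carrier G - H. g \<otimes> g = \<one>"
    and g: "g \<in> carrier G" "g \<notin> H" and k: "k \<in> carrier G" "k \<notin> H" and gk: "g \<otimes> k \<notin> H"
  shows "Boolean_group G"
  unfolding Boolean_group_def
proof (intro conjI ballI is_group)
  fix h assume h: "h \<in> carrier G"
  interpret subgroup H G by fact
  note swap = involution_outside_inverts[OF H inv2]
  show "h \<otimes> h = \<one>"
  proof (cases "h \<in> H")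
    case True
    have "(g \<otimes> k) \<otimes> inv h = h \<otimes> (g \<otimes> k)" using swap[of "g \<otimes> k"] g k gk True by simp
    also have "\<dots> = g \<otimes> (inv h \<otimes> k)"
      using swap[OF g True] g k h by (simp add: m_assoc[symmetric])
    also have "\<dots> = (g \<otimes> k) \<otimes> h"
      using swap[OF k, of "inv h"] True g k h by (simp add: m_assoc)
    finally have "inv h = h" using g k h by simp
    then show ?thesis using h by (metis r_inv)
  qed (use inv2 h in blast)
qed

end

section \<open>Isosceles-generated components\<close>

lemma equiv_isosceles_rel: "equiv X (isosceles_rel X d)"
proof (rule equivI)
  show "isosceles_rel X d \<subseteq> X \<times> X" by (auto simp: isosceles_rel_def)
  show "refl_on X (isosceles_rel X d)" by (simp add: refl_on_def isosceles_rel_def)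
  show "sym (isosceles_rel X d)"
    unfolding isosceles_rel_def using equivclp_sym by (fastforce intro!: symI)
  show "trans (isosceles_rel X d)"
    unfolding isosceles_rel_def using equivclp_trans by (fastforce intro!: transI)
qed

lemma isosceles_rel_carrier: "(x, y) \<in> isosceles_rel X d \<Longrightarrow> x \<in> X \<and> y \<in> X"
  by (simp add: isosceles_rel_def)

lemma isosceles_rel_refl: "x \<in> X \<Longrightarrow> (x, x) \<in> isosceles_rel X d"
  by (simp add: isosceles_rel_def)

lemma isosceles_rel_sym: "(x, y) \<in> isosceles_rel X d \<Longrightarrow> (y, x) \<in> isosceles_rel X d"
  using equivclp_sym[of "isosceles_pair X d" x y] by (simp add: isosceles_rel_def)

lemma isosceles_rel_trans:
  "(x, y) \<in> isosceles_rel X d \<Longrightarrow> (y, z) \<in> isosceles_rel X d \<Longrightarrow> (x, z) \<in> isosceles_rel X d"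
  using equivclp_trans[of "isosceles_pair X d" x y z] by (simp add: isosceles_rel_def)

lemma isosceles_rel_pair: "isosceles_pair X d x y \<Longrightarrow> (x, y) \<in> isosceles_rel X d"
  by (simp add: isosceles_rel_def r_into_equivclp) (simp add: isosceles_pair_def)

lemma isosceles_generated_iff:
  "isosceles_generated X d \<longleftrightarrow> (\<forall>x\<in>X. \<forall>y\<in>X. (x, y) \<in> isosceles_rel X d)"
  using eq_equiv_class_iff[OF equiv_isosceles_rel, of _ X _ d]
  by (auto simp: isosceles_generated_def isosceles_components_def quotient_def)

text \<open>A second point at the same distance would make \<open>(x, y)\<close> one of the generating pairs.\<close>

lemma unique_at_distance:
  assumes "x \<in> X" "y \<in> X" "(x, y) \<notin> isosceles_rel X d" "z \<in> X" "d x z = d x y"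
  shows "z = y"
proof (rule ccontr)
  assume "z \<noteq> y"
  then have "isosceles_pair X d x y" using assms by (auto simp: isosceles_pair_def)
  then show False using assms isosceles_rel_pair by metis
qed

text \<open>
  This serves two purposes: \<open>f\<close> is either an isometry, with \<open>C = X = Y\<close>, or the identity, with
  \<open>C = Y\<close> a component. In both cases a chain of generating pairs that starts in \<open>C\<close> never leaves it.
\<close>

lemma isosceles_rel_map:
  assumes gen: "\<And>x y. isosceles_pair X d x y \<Longrightarrow> x \<in> C \<Longrightarrow> isosceles_pair Y e (f x) (f y)"
    and C: "\<And>x y. x \<in> C \<Longrightarrow> (x, y) \<in> isosceles_rel X d \<Longrightarrow> y \<in> C"
    and "x \<in> C" "(x, y) \<in> isosceles_rel X d" "f ` C \<subseteq> Y"
  shows "(f x, f y) \<in> isosceles_rel Y e"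
proof -
  have pair: "(u, v) \<in> isosceles_rel X d" "(v, u) \<in> isosceles_rel X d"
    if "isosceles_pair X d u v" for u v
  proof -
    show "(u, v) \<in> isosceles_rel X d" by (rule isosceles_rel_pair[OF that])
    then show "(v, u) \<in> isosceles_rel X d" by (rule isosceles_rel_sym)
  qed
  have "equivclp (isosceles_pair X d) x y" using assms by (auto simp: isosceles_rel_def)
  then have "y \<in> C \<and> equivclp (isosceles_pair Y e) (f x) (f y)"
  proof (induction rule: equivclp_induct)
    case base show ?case using \<open>x \<in> C\<close> by simp
  next
    case (step u v)
    then have "v \<in> C" using C pair by blast
    moreover have "isosceles_pair Y e (f u) (f v) \<or> isosceles_pair Y e (f v) (f u)"
      using step gen \<open>v \<in> C\<close> by blast
    then have "equivclp (isosceles_pair Y e) (f u) (f v)"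
      by (rule disjE) (rule r_into_equivclp converse_r_into_equivclp, assumption)+
    ultimately show ?case using step equivclp_trans by metis
  qed
  then show ?thesis using assms by (auto simp: isosceles_rel_def)
qed

lemma Aut_isosceles_rel:
  assumes f: "f \<in> carrier (Aut X d)" and rel: "(x, y) \<in> isosceles_rel X d"
  shows "(f x, f y) \<in> isosceles_rel X d"
proof (rule isosceles_rel_map[where C = X and X = X and d = d and f = f])
  fix x y assume "isosceles_pair X d x y"
  then obtain z where z: "x \<in> X" "y \<in> X" "z \<in> X" "z \<noteq> y" "d x y = d x z"
    by (auto simp: isosceles_pair_def)
  moreover have "f z \<noteq> f y" using z f by (metis Aut_inv_left)
  ultimately show "isosceles_pair X d (f x) (f y)"
    unfolding isosceles_pair_def by (metis Aut_closed Aut_dist f)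
qed (use rel in \<open>auto dest: isosceles_rel_carrier Aut_closed[OF f]\<close>)

lemma Aut_isosceles_rel_iff:
  assumes f: "f \<in> carrier (Aut X d)" and "x \<in> X" "y \<in> X"
  shows "(f x, f y) \<in> isosceles_rel X d \<longleftrightarrow> (x, y) \<in> isosceles_rel X d"
proof
  interpret group "Aut X d" by (rule group_Aut)
  assume "(f x, f y) \<in> isosceles_rel X d"
  then show "(x, y) \<in> isosceles_rel X d"
    using Aut_isosceles_rel[of "inv\<^bsub>Aut X d\<^esub> f" X d "f x" "f y"] assms by (simp add: Aut_inv_left)
qed (rule Aut_isosceles_rel[OF f])

text \<open>
  The third point that witnesses a generating pair at \<open>u\<close> is itself related to \<open>u\<close>, so the chains
  inside a component are built from pairs of that component alone.
\<close>

lemma isosceles_generated_component: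
  "isosceles_generated (isosceles_rel X d `` {a}) d"
  unfolding isosceles_generated_iff
proof (intro ballI)
  fix x y assume xy: "x \<in> isosceles_rel X d `` {a}" "y \<in> isosceles_rel X d `` {a}"
  let ?C = "isosceles_rel X d `` {a}"
  have "(id x, id y) \<in> isosceles_rel ?C d"
  proof (rule isosceles_rel_map[where C = ?C and X = X and d = d and f = id])
    fix u v assume uv: "isosceles_pair X d u v" and u: "u \<in> ?C"
    then obtain z where z: "u \<in> X" "v \<in> X" "z \<in> X" "z \<noteq> v" "d u v = d u z"
      by (auto simp: isosceles_pair_def)
    then have "isosceles_pair X d u v" "isosceles_pair X d u z"
      by (auto simp: isosceles_pair_def)
    then have "(u, v) \<in> isosceles_rel X d" "(u, z) \<in> isosceles_rel X d"
      by (blast intro: isosceles_rel_pair)+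
    with u have "v \<in> ?C" "z \<in> ?C" by (auto intro: isosceles_rel_trans)
    with u z show "isosceles_pair ?C d (id u) (id v)" by (auto simp: isosceles_pair_def)
  next
    have "(x, a) \<in> isosceles_rel X d" "(a, y) \<in> isosceles_rel X d"
      using xy isosceles_rel_sym by fast+
    then show "(x, y) \<in> isosceles_rel X d" by (rule isosceles_rel_trans)
  next
    fix u v assume "u \<in> ?C" "(u, v) \<in> isosceles_rel X d"
    then show "v \<in> ?C" using isosceles_rel_trans by fast
  qed (use xy in auto)
  then show "(x, y) \<in> isosceles_rel ?C d" by simp
qed

section \<open>Homogeneous spaces with several components\<close>

locale separated_homogeneous = Metric_space X d for X :: "'a set" and d +
  assumes homogeneous: "n_homogeneous 1 X d"
    and not_generated: "\<not> isosceles_generated X d"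
begin

sublocale G: group "Aut X d" by (rule group_Aut)

abbreviation G where "G \<equiv> carrier (Aut X d)"

lemma G_closed: "f \<in> G \<Longrightarrow> x \<in> X \<Longrightarrow> f x \<in> X"
  by (rule Aut_closed)

abbreviation R where "R \<equiv> isosceles_rel X d"

lemma transitive:
  assumes "x \<in> X" "y \<in> X" obtains f where "f \<in> G" "f x = y"
  using assms homogeneous one_homogeneous_iff_transitive[OF Metric_space_axioms] by blast

lemma ex_unrelated:
  assumes "x \<in> X" shows "\<exists>y\<in>X. (x, y) \<notin> R"
  using not_generated assms isosceles_rel_sym isosceles_rel_trans
  unfolding isosceles_generated_iff by metis

lemma fixes_unrelated:
  assumes "f \<in> G" "x \<in> X" "f x = x" "y \<in> X" "(x, y) \<notin> R"
  shows "f y = y"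
proof (rule unique_at_distance)
  show "d x (f y) = d x y" using Aut_dist[of f X d x y] assms by simp
qed (use assms Aut_closed in auto)

text \<open>
  Every point is unrelated to \<open>x\<close> or to a fixed \<open>y\<close> outside the component of \<open>x\<close>, and \<open>y\<close> is fixed
  because \<open>x\<close> is.
\<close>

lemma fixed_point_free:
  assumes "f \<in> G" "x \<in> X" "f x = x"
  shows "f = \<one>\<^bsub>Aut X d\<^esub>"
proof (rule Aut_eqI[OF assms(1) G.one_closed])
  obtain y where y: "y \<in> X" "(x, y) \<notin> R" using ex_unrelated assms by blast
  fix u assume u: "u \<in> X"
  have "f u = u"
  proof (cases "(x, u) \<in> R")
    case True
    then have "(y, u) \<notin> R" using y by (meson isosceles_rel_sym isosceles_rel_trans)
    then show ?thesis using fixes_unrelated assms y u by metis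
  qed (rule fixes_unrelated[OF assms u])
  then show "f u = \<one>\<^bsub>Aut X d\<^esub> u" using u by (simp add: Aut_one_apply)
qed

lemma eq_if_agree:
  assumes f: "f \<in> G" and g: "g \<in> G" and x: "x \<in> X" and eq: "f x = g x"
  shows "f = g"
proof -
  have "(inv\<^bsub>Aut X d\<^esub> g \<otimes>\<^bsub>Aut X d\<^esub> f) x = x"
    using assms by (simp add: Aut_mult_apply Aut_inv_left)
  then have "inv\<^bsub>Aut X d\<^esub> g \<otimes>\<^bsub>Aut X d\<^esub> f = \<one>\<^bsub>Aut X d\<^esub>"
    using fixed_point_free[OF _ x] f g by simp
  then show ?thesis using f g by (metis G.inv_closed G.inv_equality G.inv_inv)
qed

text \<open>
  The points \<open>x\<close> and \<open>f (f x)\<close> are equally far from \<open>f x\<close>, and \<open>x\<close> is the only point at this distance.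
\<close>

lemma involution_if_leaves_component:
  assumes f: "f \<in> G" and x: "x \<in> X" and leaves: "(x, f x) \<notin> R"
  shows "f \<otimes>\<^bsub>Aut X d\<^esub> f = \<one>\<^bsub>Aut X d\<^esub>"
proof (rule fixed_point_free[OF _ x])
  have fx: "f x \<in> X" "f (f x) \<in> X" using f x by (simp_all add: G_closed)
  have "f (f x) = x"
  proof (rule unique_at_distance[of "f x" X x d])
    show "(f x, x) \<notin> R" using leaves isosceles_rel_sym[of "f x" x X d] by blast
    show "d (f x) (f (f x)) = d (f x) x" using Aut_dist[OF f x fx(1)] commute by metis
  qed (use x fx in auto)
  then show "(f \<otimes>\<^bsub>Aut X d\<^esub> f) x = x" using f x by (simp add: Aut_mult_apply)
qed (use f in simp)

text \<open>
  As isometries permute the components, keeping one point in its component is the same as mapping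
  that component to itself.
\<close>

definition component_stabilizer :: "'a \<Rightarrow> ('a \<Rightarrow> 'a) set" where
  "component_stabilizer x = {f \<in> G. (x, f x) \<in> R}"

lemma subgroup_component_stabilizer:
  assumes x: "x \<in> X" shows "subgroup (component_stabilizer x) (Aut X d)"
proof (rule G.subgroupI)
  show "component_stabilizer x \<subseteq> G" by (auto simp: component_stabilizer_def)
  have "\<one>\<^bsub>Aut X d\<^esub> \<in> component_stabilizer x"
    using x by (simp add: component_stabilizer_def Aut_one_apply isosceles_rel_refl)
  then show "component_stabilizer x \<noteq> {}" by blast
next
  fix f assume "f \<in> component_stabilizer x"
  then have f: "f \<in> G" "(x, f x) \<in> R" by (auto simp: component_stabilizer_def)
  from Aut_isosceles_rel[OF G.inv_closed[OF f(1)] f(2)]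
  have "((inv\<^bsub>Aut X d\<^esub> f) x, x) \<in> R" using f x by (simp add: Aut_inv_left)
  then show "inv\<^bsub>Aut X d\<^esub> f \<in> component_stabilizer x"
    using f by (simp add: component_stabilizer_def isosceles_rel_sym)
next
  fix f g assume "f \<in> component_stabilizer x" "g \<in> component_stabilizer x"
  then have fg: "f \<in> G" "(x, f x) \<in> R" "g \<in> G" "(x, g x) \<in> R"
    by (auto simp: component_stabilizer_def)
  then have "(x, f (g x)) \<in> R" using Aut_isosceles_rel isosceles_rel_trans by metis
  then show "f \<otimes>\<^bsub>Aut X d\<^esub> g \<in> component_stabilizer x"
    using fg x by (simp add: component_stabilizer_def Aut_mult_apply)
qed

lemma involution_outside_stabilizer:
  assumes "x \<in> X"
  shows "\<forall>f\<in>G - component_stabilizer x. f \<otimes>\<^bsub>Aut X d\<^esub> f = \<one>\<^bsub>Aut X d\<^esub>"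
proof
  fix f assume "f \<in> G - component_stabilizer x"
  then have "f \<in> G" "(x, f x) \<notin> R" by (simp_all add: component_stabilizer_def)
  then show "f \<otimes>\<^bsub>Aut X d\<^esub> f = \<one>\<^bsub>Aut X d\<^esub>"
    using involution_if_leaves_component[OF _ assms] by blast
qed

lemma Boolean_if_three_components:
  assumes xyz: "x \<in> X" "y \<in> X" "z \<in> X"
    and unrel: "(x, y) \<notin> R" "(x, z) \<notin> R" "(y, z) \<notin> R"
  shows "Boolean_metric_space X d"
proof -
  obtain f where f: "f \<in> G" "f x = y" using transitive xyz by blast
  obtain k where k: "k \<in> G" "k x = z" using transitive xyz by blast
  \<comment> \<open>The elements \<open>f\<close>, \<open>inv f \<otimes> k\<close> and their product \<open>k\<close> all move \<open>x\<close> out of its component.\<close>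
  let ?g = "inv\<^bsub>Aut X d\<^esub> f \<otimes>\<^bsub>Aut X d\<^esub> k"
  have g: "?g \<in> G" using f k by simp
  have fg: "f \<otimes>\<^bsub>Aut X d\<^esub> ?g = k" using f k by (simp add: G.m_assoc[symmetric])
  then have "f (?g x) = z" using Aut_mult_apply[OF f(1) g xyz(1)] k by simp
  then have "(f x, f (?g x)) \<notin> R" using f unrel by simp
  then have "(x, ?g x) \<notin> R" using Aut_isosceles_rel f by metis
  then have "Boolean_group (Aut X d)"
    using G.Boolean_of_involution_outside[OF subgroup_component_stabilizer[OF xyz(1)]
        involution_outside_stabilizer[OF xyz(1)], of f ?g] f k g fg unrel xyz
    by (simp add: component_stabilizer_def)
  then show ?thesis
    using Metric_space_axioms homogeneous xyz by (auto simp: Boolean_metric_space_def)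
qed

end

section \<open>Two components form a rainbow duplicate\<close>

locale two_components = separated_homogeneous X d for X :: "'a set" and d +
  fixes a w :: 'a
  assumes a: "a \<in> X" and w: "w \<in> X" and aw: "(a, w) \<notin> isosceles_rel X d"
    and cover: "\<And>x. x \<in> X \<Longrightarrow> (a, x) \<in> isosceles_rel X d \<or> (w, x) \<in> isosceles_rel X d"
begin

definition C where "C = R `` {a}"

abbreviation H where "H \<equiv> component_stabilizer a"

lemma C_subset: "C \<subseteq> X" by (auto simp: C_def dest: isosceles_rel_carrier)

lemma H_G: "h \<in> H \<Longrightarrow> h \<in> G" by (simp add: component_stabilizer_def)

lemma a_C: "a \<in> C" using a by (simp add: C_def isosceles_rel_refl)

lemma H_closed:
  assumes "h \<in> H" "x \<in> C" shows "h x \<in> C"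
proof -
  have "(a, h a) \<in> R" "(h a, h x) \<in> R"
    using assms Aut_isosceles_rel[of h X d a x] by (simp_all add: C_def component_stabilizer_def)
  then have "(a, h x) \<in> R" by (rule isosceles_rel_trans)
  then show ?thesis by (simp add: C_def)
qed

lemma H_mem_iff:
  assumes "f \<in> G" "x \<in> C" shows "f \<in> H \<longleftrightarrow> f x \<in> C"
proof
  assume "f x \<in> C"
  then have "(a, f x) \<in> R" by (simp add: C_def)
  moreover have "(x, a) \<in> R" using assms isosceles_rel_sym[of a x X d] by (simp add: C_def)
  then have "(f x, f a) \<in> R" by (rule Aut_isosceles_rel[OF assms(1)])
  ultimately have "(a, f a) \<in> R" by (rule isosceles_rel_trans)
  then show "f \<in> H" using assms by (simp add: component_stabilizer_def)
qed (rule H_closed[OF _ assms(2)])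

lemma H_transitive:
  assumes "x \<in> C" "y \<in> C" obtains h where "h \<in> H" "h x = y"
proof -
  obtain h where "h \<in> G" "h x = y" using transitive assms C_subset by blast
  then show thesis using that H_mem_iff[of h x] assms by simp
qed

lemma sub_H: "subgroup H (Aut X d)" by (rule subgroup_component_stabilizer[OF a])

lemma inverting:
  obtains t where "t \<in> G" "t a = w" "\<And>h. h \<in> H \<Longrightarrow> h \<otimes>\<^bsub>Aut X d\<^esub> t = t \<otimes>\<^bsub>Aut X d\<^esub> inv\<^bsub>Aut X d\<^esub> h"
proof -
  obtain t where t: "t \<in> G" "t a = w" using transitive a w by blast
  then have "t \<notin> H" using aw by (simp add: component_stabilizer_def)
  with t that show thesis
    using G.involution_outside_inverts[OF sub_H involution_outside_stabilizer[OF a]] by blast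
qed

lemma H_commute:
  assumes "h \<in> H" "k \<in> H" shows "h \<otimes>\<^bsub>Aut X d\<^esub> k = k \<otimes>\<^bsub>Aut X d\<^esub> h"
proof -
  obtain t where t: "t \<in> G" "t a = w" using transitive a w by blast
  then have "t \<notin> H" using aw by (simp add: component_stabilizer_def)
  with t show ?thesis
    using G.commute_of_involution_outside[OF sub_H involution_outside_stabilizer[OF a]] assms
    by blast
qed

lemma H_commute_apply:
  assumes "h \<in> H" "k \<in> H" "x \<in> X" shows "h (k x) = k (h x)"
proof -
  note G = H_G[OF assms(1)] H_G[OF assms(2)]
  have "h (k x) = (h \<otimes>\<^bsub>Aut X d\<^esub> k) x" by (simp only: Aut_mult_apply[OF G assms(3)])
  also have "\<dots> = (k \<otimes>\<^bsub>Aut X d\<^esub> h) x" by (simp only: H_commute[OF assms(1,2)])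
  also have "\<dots> = k (h x)" by (simp only: Aut_mult_apply[OF G(2,1) assms(3)])
  finally show ?thesis .
qed

text \<open>Apply the isometry \<open>h \<otimes> k = k \<otimes> h\<close> to both points: they become \<open>k a\<close> and \<open>h a\<close>.\<close>

lemma inverse_orbit_dist:
  assumes "h \<in> H" "k \<in> H"
  shows "d ((inv\<^bsub>Aut X d\<^esub> h) a) ((inv\<^bsub>Aut X d\<^esub> k) a) = d (h a) (k a)"
proof -
  note G = H_G[OF assms(1)] H_G[OF assms(2)]
  let ?h = "inv\<^bsub>Aut X d\<^esub> h" and ?k = "inv\<^bsub>Aut X d\<^esub> k"
  have X: "?h a \<in> X" "?k a \<in> X" "k (?h a) \<in> X" "k (?k a) \<in> X"
    using a G by (simp_all add: G_closed)
  have "d (?h a) (?k a) = d (h (k (?h a))) (h (k (?k a)))"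
    by (simp only: Aut_dist[OF G(1) X(3,4)] Aut_dist[OF G(2) X(1,2)])
  also have "h (k (?h a)) = k a"
    using H_commute_apply[OF assms X(1)] G a by (simp add: Aut_inv_right)
  also have "h (k (?k a)) = h a" using G a by (simp add: Aut_inv_right)
  finally show ?thesis by (simp add: commute)
qed

text \<open>
  Points of the other component satisfy \<open>h w = h (t a) = t (inv h a)\<close> for the isometry \<open>t\<close> that takes
  \<open>a\<close> to \<open>w\<close>, so this is inversion on \<open>C\<close> again, transported by \<open>t\<close>.
\<close>

lemma orbit_dist:
  assumes "h \<in> H" "k \<in> H"
  shows "d (h w) (k w) = d (h a) (k a)"
proof -
  note G = H_G[OF assms(1)] H_G[OF assms(2)]
  obtain t where t: "t \<in> G" "t a = w"
    and inv: "\<And>h. h \<in> H \<Longrightarrow> h \<otimes>\<^bsub>Aut X d\<^esub> t = t \<otimes>\<^bsub>Aut X d\<^esub> inv\<^bsub>Aut X d\<^esub> h"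
    by (rule inverting) blast
  have "f w = t ((inv\<^bsub>Aut X d\<^esub> f) a)" if "f \<in> H" for f
    using inv[OF that] t a H_G[OF that] Aut_mult_apply[of f X d t a]
      Aut_mult_apply[of t X d "inv\<^bsub>Aut X d\<^esub> f" a] by simp
  then have "d (h w) (k w) = d ((inv\<^bsub>Aut X d\<^esub> h) a) ((inv\<^bsub>Aut X d\<^esub> k) a)"
    using assms Aut_dist[OF t(1), of "(inv\<^bsub>Aut X d\<^esub> h) a" "(inv\<^bsub>Aut X d\<^esub> k) a"] a G
    by (simp add: G_closed)
  then show ?thesis using inverse_orbit_dist[OF assms] by simp
qed

text \<open>The regular action identifies \<open>C\<close> with \<open>H\<close> once the base point \<open>a\<close> is chosen.\<close>

definition coord where "coord y = transl H a y"

lemma coord: assumes "y \<in> C" shows "coord y \<in> H" "coord y a = y"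
proof -
  obtain h where "h \<in> H" "h a = y" by (rule H_transitive[OF a_C assms])
  then have "\<exists>!h. h \<in> H \<and> h a = y" by (auto intro: eq_if_agree[OF H_G H_G a])
  from theI'[OF this] show "coord y \<in> H" "coord y a = y" by (simp_all add: coord_def transl_def)
qed

lemma coord_eq: assumes "h \<in> H" shows "coord (h a) = h"
  using coord[OF H_closed[OF assms a_C]] assms by (intro eq_if_agree[OF _ _ a] H_G)

text \<open>
  \<open>Aut(C)\<close> consists of functions that are extensional on \<open>C\<close>, so \<open>H\<close> enters it only after restriction.
\<close>

definition K where "K = (\<lambda>h. restrict h C) ` H"

lemma restrict_Aut:
  assumes h: "h \<in> H" shows "restrict h C \<in> carrier (Aut C d)"
proof -
  interpret subgroup H "Aut X d" by (rule sub_H)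
  have hG: "h \<in> G" using h by (rule H_G)
  have "bij_betw h C C"
  proof (rule bij_betw_byWitness[where f' = "inv\<^bsub>Aut X d\<^esub> h"])
    show "h ` C \<subseteq> C" "(inv\<^bsub>Aut X d\<^esub> h) ` C \<subseteq> C" using h H_closed by auto
  qed (use hG C_subset in \<open>auto simp: Aut_inv_left Aut_inv_right\<close>)
  then show ?thesis
    using hG C_subset by (auto simp: mem_Aut_iff)
qed

lemma restrict_hom:
  "(\<lambda>h. restrict h C) \<in> hom ((Aut X d)\<lparr>carrier := H\<rparr>) (Aut C d)"
proof (rule homI)
  fix f g assume fg: "f \<in> carrier ((Aut X d)\<lparr>carrier := H\<rparr>)" "g \<in> carrier ((Aut X d)\<lparr>carrier := H\<rparr>)"
  then have fg: "f \<in> H" "g \<in> H" by simp_all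
  have "restrict (compose X f g) C = compose C (restrict f C) (restrict g C)"
    using C_subset H_closed[OF fg(2)] by (auto simp: compose_def fun_eq_iff)
  then show "restrict (f \<otimes>\<^bsub>(Aut X d)\<lparr>carrier := H\<rparr>\<^esub> g) C = restrict f C \<otimes>\<^bsub>Aut C d\<^esub> restrict g C"
    by (simp add: Aut_mult[OF H_G H_G] Aut_mult[OF restrict_Aut restrict_Aut] fg)
qed (use restrict_Aut in auto)

lemma subgroup_K: "subgroup K (Aut C d)"
proof -
  interpret group_hom "(Aut X d)\<lparr>carrier := H\<rparr>" "Aut C d" "\<lambda>h. restrict h C"
    using restrict_hom subgroup.subgroup_is_group[OF sub_H G.is_group] group_Aut
    by (simp add: group_hom_def group_hom_axioms_def)
  from img_is_subgroup show ?thesis by (simp add: K_def)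
qed

lemma K_comm: "comm_group ((Aut C d)\<lparr>carrier := K\<rparr>)"
proof (rule group.group_comm_groupI)
  show "group ((Aut C d)\<lparr>carrier := K\<rparr>)"
    using subgroup.subgroup_is_group[OF subgroup_K group_Aut] .
next
  fix f g assume "f \<in> carrier ((Aut C d)\<lparr>carrier := K\<rparr>)" "g \<in> carrier ((Aut C d)\<lparr>carrier := K\<rparr>)"
  then obtain h k where hk: "h \<in> H" "k \<in> H" "f = restrict h C" "g = restrict k C"
    by (auto simp: K_def)
  then show "f \<otimes>\<^bsub>(Aut C d)\<lparr>carrier := K\<rparr>\<^esub> g = g \<otimes>\<^bsub>(Aut C d)\<lparr>carrier := K\<rparr>\<^esub> f"
    using hom_mult[OF restrict_hom, of h k] hom_mult[OF restrict_hom, of k h] H_commute by simp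
qed

lemma K_regular:
  assumes "x \<in> C" "y \<in> C" shows "\<exists>!h. h \<in> K \<and> h x = y"
proof -
  obtain h where h: "h \<in> H" "h x = y" by (rule H_transitive[OF assms])
  show ?thesis
  proof (rule ex1I[of _ "restrict h C"])
    show "restrict h C \<in> K \<and> restrict h C x = y" using h assms by (simp add: K_def)
    fix k assume "k \<in> K \<and> k x = y"
    then obtain k' where "k' \<in> H" "k = restrict k' C" "k' x = y" using assms by (auto simp: K_def)
    then show "k = restrict h C"
      using h eq_if_agree[of k' h x] H_G assms C_subset by auto
  qed
qed

lemma transl_K:
  assumes "h \<in> H" "x \<in> C" shows "transl K x (h x) = restrict h C"
  unfolding transl_def
  using K_regular[OF assms(2) H_closed[OF assms]] assms by (intro the1_equality) (auto simp: K_def)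

lemma metric_C: "Metric_space C d"
  by (rule subspace[OF C_subset])

lemma homogeneous_C: "n_homogeneous 1 C d"
  unfolding one_homogeneous_iff_transitive[OF metric_C]
proof (intro ballI)
  fix x y assume xy: "x \<in> C" "y \<in> C"
  then obtain h where h: "h \<in> H" "h x = y" by (rule H_transitive)
  then have "restrict h C x = y" using xy by simp
  then show "\<exists>F\<in>carrier (Aut C d). F x = y" using restrict_Aut[OF h(1)] by blast
qed

text \<open>The map \<open>h a \<mapsto> inv h a\<close>, written as a function of the point \<open>h a\<close>.\<close>

definition reflection where "reflection = (\<lambda>y\<in>C. (inv\<^bsub>Aut X d\<^esub> (coord y)) a)"

lemma inv_H: "h \<in> H \<Longrightarrow> inv\<^bsub>Aut X d\<^esub> h \<in> H"
  using subgroup.m_inv_closed[OF sub_H] .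

lemma reflection_orbit: "h \<in> H \<Longrightarrow> reflection (h a) = (inv\<^bsub>Aut X d\<^esub> h) a"
  using H_closed[OF _ a_C] by (simp add: reflection_def coord_eq)

lemma C_cases: assumes "y \<in> C" obtains h where "h \<in> H" "y = h a"
  using coord[OF assms] that by simp

lemma reflection_C: "y \<in> C \<Longrightarrow> reflection y \<in> C"
  by (erule C_cases) (simp add: reflection_orbit inv_H H_closed a_C)

lemma reflection_reflection: "y \<in> C \<Longrightarrow> reflection (reflection y) = y"
  by (erule C_cases) (simp add: reflection_orbit inv_H H_G)

lemma reflection_Aut: "reflection \<in> carrier (Aut C d)"
proof -
  have "bij_betw reflection C C"
    by (rule bij_betw_byWitness[where f' = reflection])
      (auto simp: reflection_C reflection_reflection)
  moreover have "d (reflection x) (reflection y) = d x y" if "x \<in> C" "y \<in> C" for x y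
    by (rule C_cases[OF that(1)], rule C_cases[OF that(2)])
      (simp add: reflection_orbit inverse_orbit_dist)
  ultimately show ?thesis by (auto simp: mem_Aut_iff reflection_def)
qed

lemma reflection_apply:
  assumes h: "h \<in> H" and y: "y \<in> C"
  shows "reflection (h y) = (inv\<^bsub>Aut X d\<^esub> h) (reflection y)"
proof -
  obtain k where k: "k \<in> H" "y = k a" using y by (rule C_cases)
  have hk: "h \<otimes>\<^bsub>Aut X d\<^esub> k \<in> H" using h k by (intro subgroup.m_closed[OF sub_H])
  have "h y = (h \<otimes>\<^bsub>Aut X d\<^esub> k) a" using h k a H_G by (simp add: Aut_mult_apply)
  then have "reflection (h y) = (inv\<^bsub>Aut X d\<^esub> (k \<otimes>\<^bsub>Aut X d\<^esub> h)) a"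
    using reflection_orbit[OF hk] H_commute h k by simp
  also have "\<dots> = (inv\<^bsub>Aut X d\<^esub> h) ((inv\<^bsub>Aut X d\<^esub> k) a)"
    using h k a H_G by (simp add: G.inv_mult_group Aut_mult_apply)
  finally show ?thesis using k by (simp add: reflection_orbit)
qed

lemma inv_restrict:
  assumes "h \<in> H" shows "inv\<^bsub>Aut C d\<^esub> (restrict h C) = restrict (inv\<^bsub>Aut X d\<^esub> h) C"
proof (rule group.inv_equality[OF group_Aut])
  have "restrict (inv\<^bsub>Aut X d\<^esub> h) C \<otimes>\<^bsub>Aut C d\<^esub> restrict h C
      = restrict (inv\<^bsub>Aut X d\<^esub> h \<otimes>\<^bsub>Aut X d\<^esub> h) C"
    using hom_mult[OF restrict_hom, of "inv\<^bsub>Aut X d\<^esub> h" h] assms inv_H by simp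
  also have "\<dots> = \<one>\<^bsub>Aut C d\<^esub>" using assms H_G C_subset by (simp add: Aut_one Int_absorb1)
  finally show "restrict (inv\<^bsub>Aut X d\<^esub> h) C \<otimes>\<^bsub>Aut C d\<^esub> restrict h C = \<one>\<^bsub>Aut C d\<^esub>" .
qed (use assms restrict_Aut inv_H in auto)

lemma reflection_inverts:
  "reflection \<otimes>\<^bsub>Aut C d\<^esub> reflection = \<one>\<^bsub>Aut C d\<^esub>" (is ?A)
  "k \<in> K \<Longrightarrow> reflection \<otimes>\<^bsub>Aut C d\<^esub> k \<otimes>\<^bsub>Aut C d\<^esub> inv\<^bsub>Aut C d\<^esub> reflection = inv\<^bsub>Aut C d\<^esub> k"
proof -
  interpret C: group "Aut C d" by (rule group_Aut)
  show sq: ?A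
    by (rule Aut_eqI[of _ C d]) (use reflection_Aut in \<open>auto simp: Aut_mult_apply Aut_one_apply reflection_reflection\<close>)
  have inv: "inv\<^bsub>Aut C d\<^esub> reflection = reflection"
    using sq reflection_Aut by (metis C.inv_equality)
  assume "k \<in> K"
  then obtain h where h: "h \<in> H" "k = restrict h C" by (auto simp: K_def)
  have kA: "k \<in> carrier (Aut C d)" using h restrict_Aut by simp
  show "reflection \<otimes>\<^bsub>Aut C d\<^esub> k \<otimes>\<^bsub>Aut C d\<^esub> inv\<^bsub>Aut C d\<^esub> reflection = inv\<^bsub>Aut C d\<^esub> k"
  proof (rule Aut_eqI[of _ C d])
    fix y assume y: "y \<in> C"
    have "(reflection \<otimes>\<^bsub>Aut C d\<^esub> k \<otimes>\<^bsub>Aut C d\<^esub> inv\<^bsub>Aut C d\<^esub> reflection) y = reflection (h (reflection y))"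
      using y kA reflection_Aut h by (simp add: inv Aut_mult_apply reflection_C)
    also have "\<dots> = (inv\<^bsub>Aut X d\<^esub> h) y"
      using reflection_apply[OF h(1) reflection_C[OF y]] y by (simp add: reflection_reflection)
    finally show "(reflection \<otimes>\<^bsub>Aut C d\<^esub> k \<otimes>\<^bsub>Aut C d\<^esub> inv\<^bsub>Aut C d\<^esub> reflection) y = (inv\<^bsub>Aut C d\<^esub> k) y"
      using y h inv_restrict by simp
  qed (use kA reflection_Aut in auto)
qed

text \<open>
  The distance between \<open>a\<close> and \<open>h w\<close>, as a function of the restriction of \<open>h\<close> to \<open>C\<close>; the value at
  \<open>a\<close> is enough to recover \<open>h\<close>.
\<close>

definition r where "r k = d a (coord (k a) w)"

lemma r_restrict: "h \<in> H \<Longrightarrow> r (restrict h C) = d a (h w)"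
  using a_C by (simp add: r_def coord_eq)

lemma orbit_w:
  assumes "h \<in> H" shows "h w \<in> X" "(a, h w) \<notin> R"
proof -
  show "h w \<in> X" using assms w H_G Aut_closed by metis
  have "(h a, h w) \<notin> R" using Aut_isosceles_rel_iff[OF H_G[OF assms] a w] aw by simp
  moreover have "(a, h a) \<in> R" using assms by (simp add: component_stabilizer_def)
  then have "(h a, a) \<in> R" by (rule isosceles_rel_sym)
  ultimately show "(a, h w) \<notin> R" using isosceles_rel_trans[of "h a" a X d "h w"] by blast
qed

text \<open>The distance determines the point \<open>h w\<close> of the other component, and that point determines \<open>h\<close>.\<close>

lemma inj_r: "inj_on r K"
proof (rule inj_onI)
  fix f g assume "f \<in> K" "g \<in> K" and eq: "r f = r g"
  then obtain h k where hk: "h \<in> H" "k \<in> H" "f = restrict h C" "g = restrict k C"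
    by (auto simp: K_def)
  then have "h w = k w"
    using eq r_restrict orbit_w a unique_at_distance[of a X "k w" d "h w"] by simp
  then show "f = g" using hk eq_if_agree H_G w by metis
qed

text \<open>
  If a distance within \<open>C\<close> were a cross distance, it could be moved so as to start at \<open>a\<close>. Its other
  end would be the only point at this distance from \<open>a\<close>, which lies outside \<open>C\<close>.
\<close>

lemma range_r: "r ` K \<subseteq> {0<..} - Dist C d"
proof -
  have "d a (h w) > 0" and "d a (h w) \<notin> Dist C d" if h: "h \<in> H" for h
  proof -
    have "a \<noteq> h w" using orbit_w[OF h] a isosceles_rel_refl by metis
    then show "d a (h w) > 0" using orbit_w[OF h] a by simp
    show "d a (h w) \<notin> Dist C d"
    proof
      assume "d a (h w) \<in> Dist C d"
      then obtain x y where xy: "x \<in> C" "y \<in> C" "d a (h w) = d x y" by (auto simp: Dist_def)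
      obtain k where k: "k \<in> H" "k x = a" by (rule H_transitive[OF xy(1) a_C])
      have "d a (k y) = d a (h w)"
        using Aut_dist[OF H_G[OF k(1)], of x y] k xy C_subset by auto
      moreover have "k y \<in> C" using H_closed k xy by blast
      ultimately have "k y = h w"
        using unique_at_distance[of a X "h w" d "k y"] orbit_w[OF h] a C_subset by auto
      then show False using \<open>k y \<in> C\<close> orbit_w[OF h] by (simp add: C_def)
    qed
  qed
  then show ?thesis by (auto simp: K_def r_restrict)
qed

text \<open>
  The two sheets of the duplicate are \<open>C\<close> and its copy \<open>h a \<mapsto> h w\<close> in the other component. Any
  isometry between the components would preserve the distances within the sheets; this one also
  commutes with \<open>H\<close>, so that the distance between \<open>(x, False)\<close> and \<open>(y, True)\<close> depends only on the
  element of \<open>H\<close> taking \<open>x\<close> to \<open>y\<close>.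
\<close>

definition sheet_map where
  "sheet_map = (\<lambda>(y, b). if b then coord y w else y)"

lemma sheet_map_dist:
  assumes "p \<in> C \<times> UNIV" "q \<in> C \<times> UNIV"
  shows "d (sheet_map p) (sheet_map q) = rainbow_dist d K r p q"
proof -
  have cross: "d x (coord y w) = r (transl K x y)" if xy: "x \<in> C" "y \<in> C" for x y
  proof -
    obtain k where k: "k \<in> H" "x = k a" using xy(1) by (rule C_cases)
    obtain h where h: "h \<in> H" "y = h x" by (rule H_transitive[OF xy]) blast
    have hk: "h \<otimes>\<^bsub>Aut X d\<^esub> k \<in> H" using h k by (intro subgroup.m_closed[OF sub_H])
    have "y = (h \<otimes>\<^bsub>Aut X d\<^esub> k) a" using h k a H_G by (simp add: Aut_mult_apply)
    then have "coord y w = k (h w)"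
      using coord_eq[OF hk] H_commute[OF h(1) k(1)] h k w H_G by (simp add: Aut_mult_apply)
    then have "d x (coord y w) = d a (h w)"
      using Aut_dist[OF H_G[OF k(1)] a orbit_w(1)[OF h(1)]] k(2) by simp
    then show ?thesis using transl_K[OF h(1) xy(1)] h by (simp add: r_restrict)
  qed
  have same: "d (coord x w) (coord y w) = d x y" if "x \<in> C" "y \<in> C" for x y
    using that coord orbit_dist by metis
  obtain x b y c where [simp]: "p = (x, b)" "q = (y, c)" by (metis surj_pair)
  have "x \<in> C" "y \<in> C" using assms by auto
  then show ?thesis
    by (cases b; cases c) (auto simp: sheet_map_def cross same commute[of "coord x w" y])
qed

lemma bij_sheet_map: "bij_betw sheet_map (C \<times> UNIV) X"
proof (rule bij_betw_imageI)
  have pos: "sheet_map p \<in> X" if "p \<in> C \<times> UNIV" for p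
    using that C_subset coord orbit_w(1) by (auto simp: sheet_map_def)
  have sep: "x \<noteq> coord y w" if "x \<in> C" "y \<in> C" for x y
    using that orbit_w(2) coord by (metis C_def Image_singleton_iff)
  show "inj_on sheet_map (C \<times> UNIV)"
  proof (rule inj_onI)
    fix p q assume pq: "p \<in> C \<times> UNIV" "q \<in> C \<times> (UNIV :: bool set)" "sheet_map p = sheet_map q"
    obtain x b y c where [simp]: "p = (x, b)" "q = (y, c)" by (metis surj_pair)
    have xy: "x \<in> C" "y \<in> C" using pq by auto
    have "coord x w = coord y w \<Longrightarrow> x = y"
      using xy coord eq_if_agree H_G w by metis
    then show "p = q" using pq xy sep[of x y] sep[of y x]
      by (auto simp: sheet_map_def split: if_splits)
  qed
  have "x \<in> sheet_map ` (C \<times> UNIV)" if x: "x \<in> X" for x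
  proof (cases "x \<in> C")
    case True
    then show ?thesis by (intro image_eqI[of _ _ "(x, False)"]) (auto simp: sheet_map_def)
  next
    case False
    \<comment> \<open>The element taking \<open>w\<close> to \<open>x\<close> preserves the component of \<open>w\<close>, hence the only other one.\<close>
    then have wx: "(w, x) \<in> R" using cover x by (auto simp: C_def)
    obtain h where h: "h \<in> G" "h w = x" using transitive x w by blast
    have "(h a, h w) \<notin> R" using Aut_isosceles_rel_iff[OF h(1) a w] aw by simp
    then have "(w, h a) \<notin> R" using h wx by (metis isosceles_rel_sym isosceles_rel_trans)
    then have "h \<in> H" using cover[of "h a"] h a G_closed
      by (auto simp: component_stabilizer_def)
    then show ?thesis using h H_closed[OF _ a_C]
      by (intro image_eqI[of _ _ "(h a, True)"]) (auto simp: sheet_map_def coord_eq)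
  qed
  with pos show "sheet_map ` (C \<times> UNIV) = X" by blast
qed

lemma rainbow: "rainbow_duplicate_of_isosceles_generated X d"
proof -
  have mem: "sheet_map p \<in> X" if "p \<in> C \<times> UNIV" for p
    using bij_sheet_map that by (auto simp: bij_betw_def)
  have "rainbow_datum C d K r"
    unfolding rainbow_datum_def
  proof (intro conjI)
    show "\<forall>p\<in>C \<times> UNIV. \<forall>q\<in>C \<times> UNIV. \<forall>s\<in>C \<times> UNIV.
        rainbow_dist d K r p s \<le> rainbow_dist d K r p q + rainbow_dist d K r q s"
      using triangle mem by (simp flip: sheet_map_dist)
    show "\<exists>g\<in>carrier (Aut C d). g \<otimes>\<^bsub>Aut C d\<^esub> g = \<one>\<^bsub>Aut C d\<^esub> \<and>
        (\<forall>h\<in>K. g \<otimes>\<^bsub>Aut C d\<^esub> h \<otimes>\<^bsub>Aut C d\<^esub> inv\<^bsub>Aut C d\<^esub> g = inv\<^bsub>Aut C d\<^esub> h)"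
      using reflection_Aut reflection_inverts by blast
    show "\<forall>x\<in>C. \<forall>y\<in>C. \<exists>!h. h \<in> K \<and> h x = y" using K_regular by blast
  qed (fact metric_C homogeneous_C subgroup_K K_comm inj_r range_r)+
  moreover have "isometric X d (C \<times> UNIV) (rainbow_dist d K r)"
    unfolding isometric_def isometry_between_def
  proof (intro exI conjI ballI)
    let ?f = "inv_into (C \<times> UNIV) sheet_map"
    show bij: "bij_betw ?f X (C \<times> UNIV)" using bij_betw_inv_into[OF bij_sheet_map] .
    fix x y assume "x \<in> X" "y \<in> X"
    moreover have "sheet_map (?f x) = x" if "x \<in> X" for x
      using bij_betw_inv_into_right[OF bij_sheet_map that] .
    moreover have "?f x \<in> C \<times> UNIV" if "x \<in> X" for x using bij that by (auto simp: bij_betw_def)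
    ultimately show "rainbow_dist d K r (?f x) (?f y) = d x y"
      by (metis sheet_map_dist)
  qed
  moreover have "isosceles_generated C d"
    unfolding C_def by (rule isosceles_generated_component)
  ultimately show ?thesis
    unfolding rainbow_duplicate_of_isosceles_generated_def rainbow_duplicate_def by blast
qed

end

section \<open>The two alternatives\<close>

context separated_homogeneous
begin

lemma rainbow_or_Boolean:
  "rainbow_duplicate_of_isosceles_generated X d \<or> Boolean_metric_space X d"
proof -
  obtain a w where aw: "a \<in> X" "w \<in> X" "(a, w) \<notin> R"
    using not_generated by (auto simp: isosceles_generated_iff)
  show ?thesis
  proof (cases "\<forall>x\<in>X. (a, x) \<in> R \<or> (w, x) \<in> R")
    case True
    then interpret two_components X d a w by unfold_locales (use aw in auto)
    show ?thesis using rainbow by blast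
  next
    case False
    then show ?thesis using Boolean_if_three_components[of a w] aw by blast
  qed
qed

text \<open>
  An isosceles triple with apex \<open>x\<close> gives an isometry that fixes \<open>x\<close> but not \<open>y\<close>, against freeness.
\<close>

lemma isosceles_free_if_two_homogeneous:
  assumes hom: "n_homogeneous 2 X d"
  shows "isosceles_free X d"
  unfolding isosceles_free_def
proof (intro ballI impI notI)
  fix x y z assume X: "x \<in> X" "y \<in> X" "z \<in> X"
    and neq: "x \<noteq> y \<and> y \<noteq> z \<and> x \<noteq> z" and eq: "d x y = d x z"
  let ?f = "\<lambda>u. if u = x then x else z"
  have "isometry_between {x, y} d {x, z} d ?f"
    using X neq eq by (auto simp: isometry_between_def bij_betw_def inj_on_def commute)
  then obtain F where F: "F \<in> G" "F x = x" "F y = z"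
    using hom[unfolded n_homogeneous_def, rule_format, of "{x, y}" "{x, z}" ?f] X neq by auto
  then have "F = \<one>\<^bsub>Aut X d\<^esub>" using fixed_point_free X by blast
  then show False using F X neq by (simp add: Aut_one_apply)
qed

end

theorem theorem5p19:
  fixes X :: "'a set" and d :: "'a \<Rightarrow> 'a \<Rightarrow> real"
  assumes "Metric_space X d" and "n_homogeneous 1 X d"
  shows "(isosceles_generated X d
            \<or> rainbow_duplicate_of_isosceles_generated X d
            \<or> Boolean_metric_space X d)
       \<and> (n_homogeneous 2 X d \<longrightarrow> isosceles_generated X d \<or> isosceles_free X d)"
proof (cases "isosceles_generated X d")
  case False
  with assms interpret separated_homogeneous X d
    by (simp add: separated_homogeneous_def separated_homogeneous_axioms_def)
  show ?thesis using rainbow_or_Boolean isosceles_free_if_two_homogeneous by blast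
qed simp

end
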